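(* Let $k,n$ be integers with $2\le k\le \frac n2$. Then the special Plücker frieze $s\mathcal P_{(k,n)}$ is a tame $\mathrm{SL}_k$-frieze over the integral domain $s\mathcal A(k,n)$.
   Context: **$\mathrm{SL}_k$-friezes.** Let $R$ be an integral domain, $k\ge 2$, $w\ge 1$. An $\mathrm{SL}_k$-frieze of width $w$ over $R$ is an array $a:\mathbb Z\times\{1,\dots,w+2k\}\to R$ (rows indexed by $m$, from bottom to top; drawn so that $(r,m+1)$ is the upper-right neighbour and $(r+1,m-1)$ the lower-right neighbour of $(r,m)$) such that $a(r,m)=0$ for $m\le k-1$ and for $m\ge w+k+2$, $a(r,k)=a(r,w+k+1)=1$ for all $r$, and every $k\times k$-diamond has determinant $1$. Here an $s\times s$-diamond is a matrix $(a(r+i-1,\,m+j-i))_{1\le i,j\le s}$ all of whose positions lie in the grid (so the diagonal consists of $s$ successive entries of row $m$). The frieze is tame if every $(k+1)\times(k+1)$-diamond has determinant $0$. **Plücker coordinates.** $\mathcal A(k,n)=\mathbb C[\mathrm{Gr}(k,n)]$ is the homogeneous coordinate ring of the Grassmannian of $k$-spaces in $n$-space with respect to the Plücker embedding, with its cluster algebra structure due to Scott. For $1\le i_1<\dots<i_k\le n$ let $p_{i_1,\dots,i_k}$ be the Plücker coordinate, extended to arbitrary $k$-tuples in $[1,n]=\{1,\dots,n\}$ by antisymmetry (in particular it is $0$ if two indices coincide). All indices are reduced modulo $n$ to representatives in $[1,n]$. For a tuple $J$, $o(J)$ denotes the tuple with the same entries (with multiplicity) arranged in weakly increasing order. $[r]^{\ell}$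 denotes $\{r,r+1,\dots,r+\ell-1\}$ (modulo $n$). A consecutive Plücker coordinate is one of the form $p_{o([r]^k)}$; these are the frozen variables. **Plücker friezes.** The Plücker frieze $\mathcal P_{(k,n)}$ is the $\mathbb Z\times\{1,\dots,n+k-1\}$-grid with entry $p_{o([r']^{k-1},m')}$ at $(r,m)$, where $r'\in[1,n]$ is the reduction of $r$ modulo $n$ and $m'\in[1,n]$ is the reduction of $m+r'-1$ modulo $n$. Let $J$ be the ideal of $\mathcal A(k,n)$ generated by all $x-1$ with $x$ a consecutive Plücker coordinate, let $s\mathcal A(k,n)=\mathcal A(k,n)/J$ (an integral domain) and $s:\mathcal A(k,n)\to s\mathcal A(k,n)$ the quotient map. The special Plücker frieze $s\mathcal P_{(k,n)}$ is obtained by applying $s$ to all entries of $\mathcal P_{(k,n)}$ (it has the shape of an $\mathrm{SL}_k$-frieze of width $w=n-k-1$). *)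

theory Defs
  imports
    "HOL-Algebra.QuotRing"
    "HOL-Combinatorics.Permutations"
    "HOL-Library.Poly_Mapping"
    "Jordan_Normal_Form.DL_Rank"
begin

section \<open>Friezes over a commutative ring\<close>

text \<open>The Leibniz determinant of the matrix \<open>(X i j)\<close>, \<open>0 \<le> i, j < s\<close>, over a ring
  with explicit carrier (the library determinants are only available for type class rings).\<close>

definition ring_det :: "('a, 'b) ring_scheme \<Rightarrow> nat \<Rightarrow> (nat \<Rightarrow> nat \<Rightarrow> 'a) \<Rightarrow> 'a" where
  "ring_det R s X =
     (\<Oplus>\<^bsub>R\<^esub>\<pi>\<in>{\<pi>. \<pi> permutes {..<s}}.
        (if evenperm \<pi> then \<one>\<^bsub>R\<^esub> else \<ominus>\<^bsub>R\<^esub> \<one>\<^bsub>R\<^esub>) \<otimes>\<^bsub>R\<^esub> (\<Otimes>\<^bsub>R\<^esub>i\<in>{..<s}. X i (\<pi> i)))"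

text \<open>The \<open>s \<times> s\<close>-diamond of \<open>a\<close> whose top left entry of the matrix is at \<open>(r, m)\<close>. Matrix
  indices start at \<open>0\<close> here, so the entry \<open>(i, j)\<close> is at \<open>(r + i, m + j - i)\<close>.\<close>

definition diamond :: "(int \<Rightarrow> int \<Rightarrow> 'a) \<Rightarrow> int \<Rightarrow> int \<Rightarrow> nat \<Rightarrow> nat \<Rightarrow> 'a" where
  "diamond a r m i j = a (r + int i) (m + int j - int i)"

definition diamond_in_grid :: "nat \<Rightarrow> nat \<Rightarrow> nat \<Rightarrow> int \<Rightarrow> bool" where
  "diamond_in_grid k w s m \<longleftrightarrow>
     (\<forall>i<s. \<forall>j<s. m + int j - int i \<in> {1..int w + 2 * int k})"

text \<open>An array on \<open>\<int> \<times> {1, \<dots>, w + 2k}\<close> is a function on all pairs of integers of which only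
  the values on the grid matter. Friezes are usually considered over integral domains; the
  conditions on the array only refer to the commutative ring structure.\<close>

definition SL_frieze :: "('a, 'b) ring_scheme \<Rightarrow> nat \<Rightarrow> nat \<Rightarrow> (int \<Rightarrow> int \<Rightarrow> 'a) \<Rightarrow> bool" where
  "SL_frieze R k w a \<longleftrightarrow>
     cring R \<and> 2 \<le> k \<and> 1 \<le> w \<and>
     (\<forall>r. \<forall>m\<in>{1..int w + 2 * int k}. a r m \<in> carrier R) \<and>
     (\<forall>r. \<forall>m\<in>{1..int k - 1}. a r m = \<zero>\<^bsub>R\<^esub>) \<and>
     (\<forall>r. \<forall>m\<in>{int w + int k + 2..int w + 2 * int k}. a r m = \<zero>\<^bsub>R\<^esub>) \<and>
     (\<forall>r. a r (int k) = \<one>\<^bsub>R\<^esub>) \<and>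
     (\<forall>r. a r (int w + int k + 1) = \<one>\<^bsub>R\<^esub>) \<and>
     (\<forall>r m. diamond_in_grid k w k m \<longrightarrow> ring_det R k (diamond a r m) = \<one>\<^bsub>R\<^esub>)"

definition tame_SL_frieze :: "('a, 'b) ring_scheme \<Rightarrow> nat \<Rightarrow> nat \<Rightarrow> (int \<Rightarrow> int \<Rightarrow> 'a) \<Rightarrow> bool" where
  "tame_SL_frieze R k w a \<longleftrightarrow>
     SL_frieze R k w a \<and>
     (\<forall>r m. diamond_in_grid k w (k + 1) m \<longrightarrow> ring_det R (k + 1) (diamond a r m) = \<zero>\<^bsub>R\<^esub>)"


section \<open>The homogeneous coordinate ring of the Grassmannian\<close>

text \<open>Polynomials are finitely supported maps from monomials to coefficients, monomials are
  finitely supported maps from variables to exponents. The variables are the \<open>k\<close>-element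
  subsets of \<open>{1, \<dots>, n}\<close>, i.e. the homogeneous coordinates of the target of the
  Pluecker embedding.\<close>

type_synonym plucker_poly = "(nat set \<Rightarrow>\<^sub>0 nat) \<Rightarrow>\<^sub>0 complex"

definition plucker_vars :: "nat \<Rightarrow> nat \<Rightarrow> nat set set" where
  "plucker_vars k n = {I. I \<subseteq> {1..n} \<and> card I = k}"

definition plucker_poly_ring :: "nat \<Rightarrow> nat \<Rightarrow> plucker_poly ring" where
  "plucker_poly_ring k n =
     \<lparr>carrier = {f. \<forall>t\<in>Poly_Mapping.keys f. Poly_Mapping.keys t \<subseteq> plucker_vars k n},
      mult = (*), one = 1, zero = 0, add = (+)\<rparr>"

definition poly_eval :: "('v \<Rightarrow> complex) \<Rightarrow> (('v \<Rightarrow>\<^sub>0 nat) \<Rightarrow>\<^sub>0 complex) \<Rightarrow> complex" where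
  "poly_eval x f =
     (\<Sum>t\<in>Poly_Mapping.keys f.
        Poly_Mapping.lookup f t * (\<Prod>v\<in>Poly_Mapping.keys t. x v ^ Poly_Mapping.lookup t v))"

text \<open>The maximal minor of a \<open>k \<times> n\<close>-matrix on the columns in \<open>I\<close>, with columns counted from
  \<open>1\<close> (library matrices count from \<open>0\<close>).\<close>

definition max_minor :: "nat \<Rightarrow> complex mat \<Rightarrow> nat set \<Rightarrow> complex" where
  "max_minor k M I = det (mat_of_cols k (map (\<lambda>i. col M (i - 1)) (sorted_list_of_set I)))"

text \<open>A point of the Grassmannian is the row space of a \<open>k \<times> n\<close>-matrix \<open>M\<close> of rank \<open>k\<close>, and its
  homogeneous coordinates under the Pluecker embedding are the maximal minors of \<open>M\<close>. As \<open>M\<close>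
  runs through all bases of the row space, one obtains all possible choices of homogeneous
  coordinates, so this is the (homogeneous) vanishing ideal of the Grassmannian.\<close>

definition grass_ideal :: "nat \<Rightarrow> nat \<Rightarrow> plucker_poly set" where
  "grass_ideal k n =
     {f \<in> carrier (plucker_poly_ring k n).
        \<forall>M\<in>carrier_mat k n. vec_space.rank k M = k \<longrightarrow> poly_eval (max_minor k M) f = 0}"

definition grass_ring :: "nat \<Rightarrow> nat \<Rightarrow> plucker_poly set ring" where
  "grass_ring k n = plucker_poly_ring k n Quot grass_ideal k n"


section \<open>Pluecker coordinates and Pluecker friezes\<close>

text \<open>The Pluecker coordinate of a tuple: antisymmetric in the entries, with sign given by the
  number of inversions.\<close>

definition plucker :: "nat \<Rightarrow> nat \<Rightarrow> nat list \<Rightarrow> plucker_poly set" where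
  "plucker k n J =
     (if \<not> distinct J then \<zero>\<^bsub>grass_ring k n\<^esub>
      else grass_ideal k n +>\<^bsub>plucker_poly_ring k n\<^esub>
        Poly_Mapping.single (Poly_Mapping.single (set J) 1)
          ((- 1) ^ card {(i, j). i < j \<and> j < length J \<and> J ! j < J ! i}))"

text \<open>The representative of an integer modulo \<open>n\<close> in \<open>{1, \<dots>, n}\<close>.\<close>

definition red :: "nat \<Rightarrow> int \<Rightarrow> nat" where
  "red n x = nat ((x - 1) mod int n) + 1"

definition cyc_interval :: "nat \<Rightarrow> int \<Rightarrow> nat \<Rightarrow> nat list" where
  "cyc_interval n r l = map (\<lambda>i. red n (r + int i)) [0..<l]"

definition consecutive_pluckers :: "nat \<Rightarrow> nat \<Rightarrow> plucker_poly set set" where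
  "consecutive_pluckers k n = {plucker k n (sort (cyc_interval n (int r) k)) | r. r \<in> {1..n}}"

definition plucker_frieze :: "nat \<Rightarrow> nat \<Rightarrow> int \<Rightarrow> int \<Rightarrow> plucker_poly set" where
  "plucker_frieze k n r m =
     (let r' = int (red n r); m' = red n (m + r' - 1)
      in plucker k n (sort (cyc_interval n r' (k - 1) @ [m'])))"

definition special_ideal :: "nat \<Rightarrow> nat \<Rightarrow> plucker_poly set set" where
  "special_ideal k n =
     Idl\<^bsub>grass_ring k n\<^esub> ((\<lambda>x. x \<ominus>\<^bsub>grass_ring k n\<^esub> \<one>\<^bsub>grass_ring k n\<^esub>) ` consecutive_pluckers k n)"

definition special_grass_ring :: "nat \<Rightarrow> nat \<Rightarrow> plucker_poly set set ring" where
  "special_grass_ring k n = grass_ring k n Quot special_ideal k n"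

definition special_map :: "nat \<Rightarrow> nat \<Rightarrow> plucker_poly set \<Rightarrow> plucker_poly set set" where
  "special_map k n x = special_ideal k n +>\<^bsub>grass_ring k n\<^esub> x"

definition special_plucker_frieze :: "nat \<Rightarrow> nat \<Rightarrow> int \<Rightarrow> int \<Rightarrow> plucker_poly set set" where
  "special_plucker_frieze k n r m = special_map k n (plucker_frieze k n r m)"

end

theory Submission
  imports Defs
begin

text \<open>
  Fix a complex \<open>k \<times> n\<close>-matrix with columns \<open>v\<^sub>1, \<dots>, v\<^sub>n\<close> and continue the sequence of columns to
  all integers by \<open>v (i + n) = (- 1) ^ (k - 1) v i\<close>. With this twist, the determinant of \<open>k\<close> columns with
  increasing indices within one period is exactly the Pluecker coordinate of the sorted residues
  (\<open>bracket_eq_max_minor\<close>). Hence the entry of the Pluecker frieze at \<open>(r, m)\<close> takes the value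
  \<open>\<phi>\<^sub>r (v (r + m - 1))\<close>, where \<open>\<phi>\<^sub>r\<close> is the linear form
  \<open>x \<mapsto> det (v r, \<dots>, v (r + k - 2), x)\<close> (\<open>poly_eval_frieze\<close>).

  The entry \<open>(i, j)\<close> of a diamond at \<open>(r, m)\<close> is therefore \<open>\<phi>\<^sub>r\<^sub>+\<^sub>i (v (r + m - 1 + j))\<close>: linear forms in
  the rows are applied to vectors in the columns, all in dimension \<open>k\<close>. A diamond of size \<open>k + 1\<close> thus has
  determinant \<open>0\<close>. For size \<open>k\<close> the determinant is that of the forms times that of the vectors. Applying
  the same forms to \<open>v (r + k - 1), \<dots>, v (r + 2 k - 2)\<close> instead gives an upper triangular matrix with
  consecutive minors on the diagonal. Writing \<open>P q = det (v q, \<dots>, v (q + k - 1))\<close>, this yields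
  (\<open>det_window_brackets\<close>)
  \<open>det (diamond) * P (r + k - 1) = P r * \<dots> * P (r + k - 1) * P (r + m - 1)\<close>.

  As these identities hold at every point of the Grassmannian, they hold in its coordinate ring. In the
  quotient all consecutive Pluecker coordinates \<open>P q\<close> become \<open>1\<close>, so the diamonds of size \<open>k\<close> have
  determinant \<open>1\<close>. The boundary rows are immediate: there the index
  tuple has a repeated entry or is consecutive.
\<close>

section \<open>Determinants of linear forms given by consecutive vectors\<close>

definition bracket :: "nat \<Rightarrow> (nat \<Rightarrow> 'a::comm_ring_1 vec) \<Rightarrow> 'a" where
  "bracket k u = det (mat k k (\<lambda>(i, j). u j $ i))"

lemma bracket_cong:
  assumes "\<And>j. j < k \<Longrightarrow> u j = w j"
  shows "bracket k u = bracket k w"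
proof -
  have "mat k k (\<lambda>(i, j). u j $ i) = mat k k (\<lambda>(i, j). w j $ i)"
    using assms by (intro eq_matI) auto
  then show ?thesis by (simp add: bracket_def)
qed

text \<open>A bracket is linear in its last vector; these are the coefficients of that linear form, namely the
  cofactors along the last column. They do not depend on the last vector \<open>u (k - 1)\<close>.\<close>

definition last_coeff :: "nat \<Rightarrow> (nat \<Rightarrow> 'a::comm_ring_1 vec) \<Rightarrow> nat \<Rightarrow> 'a" where
  "last_coeff k u c = cofactor (mat k k (\<lambda>(i, j). u j $ i)) c (k - 1)"

lemma bracket_last_column:
  assumes "0 < k"
  shows "bracket k (u(k - 1 := x)) = (\<Sum>c<k. last_coeff k u c * x $ c)"
proof -
  let ?A = "mat k k (\<lambda>(i, j). (u(k - 1 := x)) j $ i)"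
  have "mat_delete ?A c (k - 1) = mat_delete (mat k k (\<lambda>(i, j). u j $ i)) c (k - 1)" for c
    by (rule eq_matI) (auto simp: mat_delete_def)
  then have "cofactor ?A c (k - 1) = last_coeff k u c" for c
    by (simp add: last_coeff_def cofactor_def)
  moreover have "det ?A = (\<Sum>c<k. ?A $$ (c, k - 1) * cofactor ?A c (k - 1))"
    by (rule laplace_expansion_column) (use assms in auto)
  ultimately show ?thesis
    using assms by (auto simp: bracket_def mult.commute intro!: sum.cong)
qed

lemma bracket_repeated_column:
  assumes "i < k" "j < k" "i \<noteq> j" "u i = u j"
  shows "bracket k u = 0"
  unfolding bracket_def
  by (rule det_identical_columns[of _ k i j]) (use assms in \<open>auto intro!: eq_vecI\<close>)

lemma bracket_smult:
  assumes "\<And>j. j < k \<Longrightarrow> u j \<in> carrier_vec k"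
  shows "bracket k (\<lambda>j. a \<cdot>\<^sub>v u j) = a ^ k * bracket k u"
proof -
  have "mat k k (\<lambda>(i, j). (a \<cdot>\<^sub>v u j) $ i) = a \<cdot>\<^sub>m mat k k (\<lambda>(i, j). u j $ i)"
    using carrier_vecD[OF assms] by (intro eq_matI) auto
  then show ?thesis by (simp add: bracket_def)
qed

lemma bracket_smult_last:
  assumes "0 < k" "x \<in> carrier_vec k"
  shows "bracket k (u(k - 1 := a \<cdot>\<^sub>v x)) = a * bracket k (u(k - 1 := x))"
  unfolding bracket_last_column[OF assms(1)] sum_distrib_left
  using carrier_vecD[OF assms(2)] by (intro sum.cong) (auto simp: mult.left_commute)

text \<open>Moving the last of \<open>k\<close> columns to the front is a cycle of length \<open>k\<close>, of sign \<open>(- 1) ^ (k - 1)\<close>.\<close>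

lemma bracket_cycle:
  assumes "0 < k"
  shows "bracket k (\<lambda>j. if j = 0 then u (k - 1) else u (j - 1)) = (- 1) ^ (k - 1) * bracket k u"
proof -
  let ?A = "mat k k (\<lambda>(i, j). u j $ i)"
  have "det ?A = (- 1) ^ ((k - 1) * 1) *
     det (mat k k (\<lambda>(i, j). ?A $$ (i, if j < 1 then j + (k - 1) else if j < (k - 1) + 1 then j - 1 else j)))"
    by (rule det_swap_initial_cols) (use assms in auto)
  also have "mat k k (\<lambda>(i, j). ?A $$ (i, if j < 1 then j + (k - 1) else if j < (k - 1) + 1 then j - 1 else j))
    = mat k k (\<lambda>(i, j). (if j = 0 then u (k - 1) else u (j - 1)) $ i)"
    using assms by (intro eq_matI) auto
  finally show ?thesis
    by (simp add: bracket_def flip: mult.assoc power_add)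
qed

lemma det_sum_of_products:
  "det (mat k k (\<lambda>(i, j). \<Sum>c<k. f i c * x j $ c)) = det (mat k k (\<lambda>(i, c). f i c)) * bracket k x"
proof -
  have "mat k k (\<lambda>(i, j). \<Sum>c<k. f i c * x j $ c) = mat k k (\<lambda>(i, c). f i c) * mat k k (\<lambda>(i, j). x j $ i)"
    by (rule eq_matI) (auto simp: scalar_prod_def atLeast0LessThan intro!: sum.cong)
  then show ?thesis
    by (simp add: bracket_def det_mult[of _ k])
qed

text \<open>The matrix factors through \<open>k\<close>-dimensional space, so padding the left factor with a zero column
  makes it a product of square matrices one of which is singular.\<close>

lemma det_rank_deficient:
  fixes f x :: "nat \<Rightarrow> nat \<Rightarrow> 'a::comm_ring_1"
  shows "det (mat (Suc k) (Suc k) (\<lambda>(i, j). \<Sum>c<k. f i c * x j c)) = 0"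
proof -
  define F where "F = mat (Suc k) (Suc k) (\<lambda>(i, c). if c < k then f i c else 0)"
  define X where "X = mat (Suc k) (Suc k) (\<lambda>(c, j). x j c)"
  have [simp]: "F \<in> carrier_mat (Suc k) (Suc k)" "X \<in> carrier_mat (Suc k) (Suc k)"
    by (auto simp: F_def X_def)
  have "mat (Suc k) (Suc k) (\<lambda>(i, j). \<Sum>c<k. f i c * x j c) = F * X"
    by (rule eq_matI) (auto simp: F_def X_def scalar_prod_def atLeast0LessThan intro!: sum.cong)
  moreover have "det F = (\<Sum>i<Suc k. F $$ (i, k) * cofactor F i k)"
    by (rule laplace_expansion_column) auto
  then have "det F = 0" by (simp add: F_def)
  ultimately show ?thesis by (simp add: det_mult[of _ "Suc k"])
qed

text \<open>Read as a linear form in \<open>x\<close>, this is the volume spanned by \<open>x\<close> and the \<open>k - 1\<close> consecutive vectors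
  starting at \<open>v r\<close>. The entries of the frieze are values of such forms on the vectors of \<open>v\<close>.\<close>

definition window_bracket :: "nat \<Rightarrow> (int \<Rightarrow> 'a::comm_ring_1 vec) \<Rightarrow> int \<Rightarrow> 'a vec \<Rightarrow> 'a" where
  "window_bracket k v r x = bracket k ((\<lambda>j. v (r + int j))(k - 1 := x))"

lemma window_bracket_expand:
  "0 < k \<Longrightarrow> window_bracket k v r x = (\<Sum>c<k. last_coeff k (\<lambda>j. v (r + int j)) c * x $ c)"
  unfolding window_bracket_def by (rule bracket_last_column)

lemma window_bracket_smult:
  assumes "0 < k" "x \<in> carrier_vec k"
  shows "window_bracket k v r (a \<cdot>\<^sub>v x) = a * window_bracket k v r x"
  unfolding window_bracket_def by (rule bracket_smult_last) fact+

text \<open>All rows are linear forms on the same \<open>k\<close>-dimensional space, hence rank at most \<open>k\<close>. This is the source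
  of tameness.\<close>

lemma det_window_brackets_Suc:
  assumes "0 < k"
  shows "det (mat (Suc k) (Suc k) (\<lambda>(i, j). window_bracket k v (r + int i) (x j))) = 0"
  unfolding window_bracket_expand[OF assms] by (rule det_rank_deficient)

lemma window_bracket_consecutive:
  assumes "0 < k"
  shows "window_bracket k v r (v (r + int k - 1)) = bracket k (\<lambda>j. v (r + int j))"
  unfolding window_bracket_def using assms by (intro bracket_cong) (auto simp: of_nat_diff algebra_simps)

lemma window_bracket_zero:
  assumes "j < k - 1"
  shows "window_bracket k v r (v (r + int j)) = 0"
  unfolding window_bracket_def by (rule bracket_repeated_column[of j _ "k - 1"]) (use assms in auto)

text \<open>The matrix is a product of the matrix \<open>F\<close> of the linear forms and the matrix with columns \<open>x j\<close>, so its
  determinant is \<open>det F\<close> times the bracket of \<open>x\<close>. To identify \<open>det F\<close> up to a bracket, one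
  specialises \<open>x\<close> to the consecutive vectors starting at \<open>v (r + k - 1)\<close>: below the diagonal the form in row
  \<open>i\<close> is applied to one of the vectors it already contains and vanishes, and on the diagonal it is applied to
  the vector right after its window. Stating the result without division keeps it valid over every
  commutative ring.\<close>

lemma det_window_brackets:
  assumes "0 < k"
  shows "det (mat k k (\<lambda>(i, j). window_bracket k v (r + int i) (x j))) * bracket k (\<lambda>j. v (r + int k - 1 + int j))
    = (\<Prod>i<k. bracket k (\<lambda>j. v (r + int i + int j))) * bracket k x"
proof -
  define F where "F = mat k k (\<lambda>(i, c). last_coeff k (\<lambda>j. v (r + int i + int j)) c)"
  define T where "T = mat k k (\<lambda>(i, j). window_bracket k v (r + int i) (v (r + int k - 1 + int j)))"
  have factor: "det (mat k k (\<lambda>(i, j). window_bracket k v (r + int i) (x j))) = det F * bracket k x" for x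
    unfolding window_bracket_expand[OF assms] det_sum_of_products F_def ..
  have "upper_triangular T"
  proof
    fix i j assume "j < i" "i < dim_row T"
    then have "k - 1 + j - i < k - 1" "i < k"
      "(r + int i) + int (k - 1 + j - i) = r + int k - 1 + int j"
      by (auto simp: T_def)
    then show "T $$ (i, j) = 0"
      using \<open>j < i\<close> window_bracket_zero[of "k - 1 + j - i" k v "r + int i"]
      by (simp only: T_def index_mat split_conv)
  qed
  then have "det T = prod_list (diag_mat T)"
    by (rule det_upper_triangular) (auto simp: T_def)
  also have "diag_mat T = map (\<lambda>i. bracket k (\<lambda>j. v (r + int i + int j))) [0..<k]"
    using window_bracket_consecutive[OF assms, of v "r + int _"]
    by (simp add: diag_mat_def T_def algebra_simps)
  also have "prod_list \<dots> = (\<Prod>i<k. bracket k (\<lambda>j. v (r + int i + int j)))"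
    by (simp add: prod.distinct_set_conv_list[symmetric] atLeast0LessThan)
  finally have T: "det F * bracket k (\<lambda>j. v (r + int k - 1 + int j)) = (\<Prod>i<k. bracket k (\<lambda>j. v (r + int i + int j)))"
    by (simp only: T_def factor)
  show ?thesis
    unfolding factor T[symmetric] by (simp only: ac_simps)
qed

section \<open>Maximal minors as brackets of a twisted periodic sequence of columns\<close>

text \<open>Going once around the index circle should multiply a column by \<open>(- 1) ^ (k - 1)\<close>, so that the sign
  of moving a column from the end of a \<open>k\<close>-tuple to its front is compensated; \<open>wrap_sign k c\<close> is
  this factor for \<open>c\<close> turns, in either direction.\<close>

definition wrap_sign :: "nat \<Rightarrow> int \<Rightarrow> 'a::comm_ring_1" where
  "wrap_sign k c = (if even ((int k - 1) * c) then 1 else - 1)"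

lemma wrap_sign_add: "wrap_sign k (a + b) = wrap_sign k a * wrap_sign k b"
  by (auto simp: wrap_sign_def)

text \<open>Shifting all \<open>k\<close> indices by the period is harmless because \<open>k * (k - 1)\<close> is even.\<close>

lemma wrap_sign_power: "wrap_sign k c ^ k = 1"
  by (cases "even k") (auto simp: wrap_sign_def)

lemma wrap_sign_minus_one: "0 < k \<Longrightarrow> wrap_sign k (- 1) = (- 1) ^ (k - 1)"
  by (cases k) (auto simp: wrap_sign_def)

definition twisted_col :: "nat \<Rightarrow> nat \<Rightarrow> 'a::comm_ring_1 mat \<Rightarrow> int \<Rightarrow> 'a vec" where
  "twisted_col k n M i = wrap_sign k ((i - 1) div int n) \<cdot>\<^sub>v col M (red n i - 1)"

lemma twisted_col_carrier [simp]: "M \<in> carrier_mat k n \<Longrightarrow> twisted_col k n M i \<in> carrier_vec k"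
  using col_dim[of M "red n i - 1"] by (simp add: twisted_col_def)

lemma int_red: "0 < n \<Longrightarrow> int (red n x) = (x - 1) mod int n + 1"
  by (simp add: red_def)

lemma red_bounds:
  assumes "0 < n"
  shows "1 \<le> red n x" "red n x \<le> n"
proof -
  have "0 \<le> (x - 1) mod int n" "(x - 1) mod int n < int n" using assms by auto
  then show "1 \<le> red n x" "red n x \<le> n" using int_red[OF assms, of x] by linarith+
qed

lemma red_eq_iff:
  assumes "0 < n"
  shows "red n x = red n y \<longleftrightarrow> x mod int n = y mod int n"
proof -
  have "red n x = red n y \<longleftrightarrow> (x - 1) mod int n = (y - 1) mod int n"
    using int_red[OF assms, of x] int_red[OF assms, of y] by linarith
  also have "\<dots> \<longleftrightarrow> x mod int n = y mod int n"
    by (simp add: mod_eq_dvd_iff)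
  finally show ?thesis .
qed

lemma red_of_small: "1 \<le> x \<Longrightarrow> x \<le> int n \<Longrightarrow> red n x = nat x"
  by (simp add: red_def)

lemma red_add_red: "0 < n \<Longrightarrow> red n (int (red n x) + y) = red n (x + y)"
  using mod_add_left_eq[of "x - 1" "int n" "1 + y"] by (simp add: red_eq_iff int_red algebra_simps)

lemma red_inj:
  assumes "0 < n" "red n x = red n y" "\<bar>x - y\<bar> < int n"
  shows "x = y"
proof -
  have "int n dvd x - y"
    using assms by (simp add: red_eq_iff mod_eq_dvd_iff)
  then show ?thesis
    using assms(3) dvd_imp_le_int[of "x - y" "int n"] by fastforce
qed

lemma twisted_col_small:
  assumes "1 \<le> i" "i \<le> int n"
  shows "twisted_col k n M i = col M (nat i - 1)"
  using assms div_pos_pos_trivial[of "i - 1" "int n"]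
  by (simp add: twisted_col_def wrap_sign_def red_of_small)

lemma twisted_col_shift:
  assumes "0 < n"
  shows "twisted_col k n M (i + c * int n) = wrap_sign k c \<cdot>\<^sub>v twisted_col k n M i"
proof -
  have "i + c * int n - 1 = (i - 1) + c * int n" by simp
  then have "(i + c * int n - 1) div int n = c + (i - 1) div int n"
    using assms by (simp only:) simp
  moreover have "red n (i + c * int n) = red n i"
    using assms by (simp add: red_eq_iff)
  ultimately show ?thesis
    by (simp add: twisted_col_def wrap_sign_add smult_smult_assoc)
qed

lemma bracket_shift:
  assumes "0 < n" "M \<in> carrier_mat k n"
  shows "bracket k (\<lambda>j. twisted_col k n M (y j + c * int n)) = bracket k (\<lambda>j. twisted_col k n M (y j))"
  using assms by (simp add: twisted_col_shift bracket_smult wrap_sign_power)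

lemma bracket_rotate:
  assumes "0 < n" "0 < k" "M \<in> carrier_mat k n"
  shows "bracket k (\<lambda>j. twisted_col k n M (if j = 0 then y (k - 1) - int n else y (j - 1)))
    = bracket k (\<lambda>j. twisted_col k n M (y j))"
proof -
  let ?t = "twisted_col k n M"
  let ?u = "(\<lambda>j. ?t (y j))(k - 1 := ?t (y (k - 1) - int n))"
  have "?t (y (k - 1) - int n) = wrap_sign k (- 1) \<cdot>\<^sub>v ?t (y (k - 1))"
    using twisted_col_shift[OF assms(1), of k M "y (k - 1)" "- 1"] by simp
  then have "bracket k ?u = wrap_sign k (- 1) * bracket k ((\<lambda>j. ?t (y j))(k - 1 := ?t (y (k - 1))))"
    using assms by (simp only: bracket_smult_last twisted_col_carrier)
  also have "(\<lambda>j. ?t (y j))(k - 1 := ?t (y (k - 1))) = (\<lambda>j. ?t (y j))" by auto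
  finally have *: "bracket k ?u = (- 1) ^ (k - 1) * bracket k (\<lambda>j. ?t (y j))"
    by (simp only: wrap_sign_minus_one[OF assms(2)])
  have "bracket k (\<lambda>j. ?t (if j = 0 then y (k - 1) - int n else y (j - 1)))
    = bracket k (\<lambda>j. if j = 0 then ?u (k - 1) else ?u (j - 1))"
    by (rule bracket_cong) auto
  also have "\<dots> = (- 1) ^ (k - 1) * bracket k ?u"
    by (rule bracket_cycle) fact
  also have "\<dots> = bracket k (\<lambda>j. ?t (y j))"
    by (simp only: * mult.assoc[symmetric] power_mult_distrib[symmetric]) simp
  finally show ?thesis .
qed

text \<open>If the last index exceeds \<open>n\<close>, lowering it by \<open>n\<close> and moving it to the front changes neither
  the bracket nor the set of residues, keeps the indices increasing within one period, and lowers their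
  sum. Positivity of the indices makes this terminate in a tuple within \<open>{1, \<dots>, n}\<close>, for which bracket
  and sorted minor agree by definition.\<close>

lemma bracket_eq_max_minor_pos:
  assumes "0 < n" "0 < k" "M \<in> carrier_mat k n"
    and "\<And>i j. i < j \<Longrightarrow> j < k \<Longrightarrow> y i < y j"
    and "y (k - 1) < y 0 + int n"
    and "1 \<le> y 0"
  shows "bracket k (\<lambda>j. twisted_col k n M (y j)) = max_minor k M ((\<lambda>j. red n (y j)) ` {..<k})"
  using assms(4-)
proof (induction "nat (\<Sum>j<k. y j)" arbitrary: y rule: less_induct)
  case less
  have pos: "1 \<le> y j" if "j < k" for j
    using less.prems(1)[of 0 j] less.prems(3) that by (cases "j = 0") auto
  show ?case
  proof (cases "y (k - 1) \<le> int n")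
    case True
    have small: "y j \<le> int n" if "j < k" for j
    proof -
      have "j < k - 1 \<or> j = k - 1" using that by linarith
      then show ?thesis using less.prems(1)[of j "k - 1"] True assms(2) by auto
    qed
    let ?xs = "map (\<lambda>j. nat (y j)) [0..<k]"
    have "sorted_wrt (<) ?xs"
      unfolding sorted_wrt_iff_nth_less
    proof (intro allI impI)
      fix i j assume ij: "i < j" "j < length ?xs"
      then show "?xs ! i < ?xs ! j"
        using less.prems(1)[of i j] pos[of i] by (simp add: nat_less_eq_zless)
    qed
    then have "sorted_list_of_set (set ?xs) = ?xs"
      by (simp only: strict_sorted_iff sorted_list_of_set.idem_if_sorted_distinct)
    moreover have "(\<lambda>j. red n (y j)) ` {..<k} = set ?xs"
      using pos small by (auto simp: red_of_small atLeast0LessThan)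
    ultimately have "max_minor k M ((\<lambda>j. red n (y j)) ` {..<k})
        = det (mat_of_cols k (map (\<lambda>i. col M (i - 1)) ?xs))"
      by (simp only: max_minor_def)
    also have "mat_of_cols k (map (\<lambda>i. col M (i - 1)) ?xs) = mat k k (\<lambda>(i, j). twisted_col k n M (y j) $ i)"
      using pos small assms(3)
      by (intro eq_matI) (auto simp: mat_of_cols_def twisted_col_small red_of_small)
    finally show ?thesis by (simp add: bracket_def)
  next
    case False
    \<comment> \<open>The last index, lowered by one period, becomes the first.\<close>
    define z where "z j = (if j = 0 then y (k - 1) - int n else y (j - 1))" for j
    obtain l where l: "k = Suc l" using assms(2) by (cases k) auto
    have sum: "(\<Sum>j<k. z j) = (\<Sum>j<k. y j) - int n"
    proof -
      have "(\<Sum>j<k. z j) = z 0 + (\<Sum>j<l. z (Suc j))"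
        unfolding l by (rule sum.lessThan_Suc_shift)
      then show ?thesis by (simp add: z_def l)
    qed
    have "0 \<le> (\<Sum>j<k. z j)"
      unfolding z_def using pos False by (intro sum_nonneg) (auto simp: less_imp_le order.trans[OF zero_le_one])
    then have decr: "nat (\<Sum>j<k. z j) < nat (\<Sum>j<k. y j)"
      using assms(1) sum by linarith
    have mono: "z i < z j" if "i < j" "j < k" for i j
    proof (cases "i = 0")
      case True
      have "j - 1 = 0 \<or> 0 < j - 1 \<and> j - 1 < k" using that by linarith
      then have "y 0 \<le> y (j - 1)"
        using less.prems(1)[of 0 "j - 1"] by (elim disjE) auto
      then show ?thesis
        using True that less.prems(2) by (simp add: z_def)
    next
      case False
      then show ?thesis using that less.prems(1)[of "i - 1" "j - 1"] by (auto simp: z_def)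
    qed
    have wrap: "z (k - 1) < z 0 + int n"
      using less.prems(1)[of "k - 2" "k - 1"] assms by (auto simp: z_def numeral_2_eq_2)
    have first: "1 \<le> z 0" using False by (simp add: z_def)
    have "bracket k (\<lambda>j. twisted_col k n M (z j)) = max_minor k M ((\<lambda>j. red n (z j)) ` {..<k})"
      by (rule less.hyps) (use decr mono wrap first in auto)
    moreover have "bracket k (\<lambda>j. twisted_col k n M (z j)) = bracket k (\<lambda>j. twisted_col k n M (y j))"
      unfolding z_def by (rule bracket_rotate) fact+
    moreover have "(\<lambda>j. red n (z j)) ` {..<k} = (\<lambda>j. red n (y j)) ` {..<k}"
    proof -
      have "(\<lambda>j. red n (z j)) ` {..<k} = insert (red n (z 0)) ((\<lambda>j. red n (z (Suc j))) ` {..<l})"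
        by (simp add: l lessThan_Suc_eq_insert_0 image_image)
      also have "red n (z 0) = red n (y l)"
        using assms(1) by (simp add: red_eq_iff z_def l)
      also have "insert (red n (y l)) ((\<lambda>j. red n (z (Suc j))) ` {..<l}) = (\<lambda>j. red n (y j)) ` {..<k}"
        by (simp add: l lessThan_Suc z_def)
      finally show ?thesis .
    qed
    ultimately show ?thesis by simp
  qed
qed

text \<open>The twist makes the bracket of any increasing tuple within one period equal to the Pluecker coordinate
  of the sorted residues, without a sign. It is what allows the frieze, which is defined by sorting
  indices modulo \<open>n\<close>, to be handled as if there were no wrap-around.\<close>

lemma bracket_eq_max_minor:
  assumes "0 < n" "0 < k" "M \<in> carrier_mat k n"
    and "\<And>i j. i < j \<Longrightarrow> j < k \<Longrightarrow> y i < y j"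
    and "y (k - 1) < y 0 + int n"
  shows "bracket k (\<lambda>j. twisted_col k n M (y j)) = max_minor k M ((\<lambda>j. red n (y j)) ` {..<k})"
proof -
  \<comment> \<open>Shifting by this many periods makes all indices positive, as \<open>n \<ge> 1\<close>.\<close>
  define c where "c = \<bar>y 0\<bar> + 1"
  have "c * 1 \<le> c * int n"
    by (rule mult_left_mono) (use assms in \<open>auto simp: c_def\<close>)
  then have first: "1 \<le> y 0 + c * int n"
    using abs_ge_minus_self[of "y 0"] c_def by linarith
  have "bracket k (\<lambda>j. twisted_col k n M (y j + c * int n))
      = max_minor k M ((\<lambda>j. red n (y j + c * int n)) ` {..<k})"
    by (rule bracket_eq_max_minor_pos) (use assms first in auto)
  moreover have "red n (y j + c * int n) = red n (y j)" for j
    using assms by (simp add: red_eq_iff)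
  ultimately show ?thesis
    using bracket_shift[OF assms(1,3), of y c] by simp
qed

section \<open>Evaluating polynomials at points of the Grassmannian\<close>

lemma poly_eval_add: "poly_eval x (f + g) = poly_eval x f + poly_eval x g"
  unfolding poly_eval_def
  by (rule setsum_keys_plus_distrib[where f = "\<lambda>t c. c * (\<Prod>v\<in>Poly_Mapping.keys t. x v ^ Poly_Mapping.lookup t v)"])
    (auto simp: algebra_simps)

lemma poly_eval_zero [simp]: "poly_eval x 0 = 0"
  by (simp add: poly_eval_def)

lemma poly_eval_one [simp]: "poly_eval x 1 = 1"
  by (simp add: poly_eval_def)

lemma monomial_eval_add:
  fixes x :: "'v \<Rightarrow> complex"
  shows "(\<Prod>v\<in>Poly_Mapping.keys (s + t). x v ^ Poly_Mapping.lookup (s + t) v)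
   = (\<Prod>v\<in>Poly_Mapping.keys s. x v ^ Poly_Mapping.lookup s v) * (\<Prod>v\<in>Poly_Mapping.keys t. x v ^ Poly_Mapping.lookup t v)"
proof -
  let ?A = "Poly_Mapping.keys s \<union> Poly_Mapping.keys t"
  have ext: "(\<Prod>v\<in>Poly_Mapping.keys u. x v ^ Poly_Mapping.lookup u v) = (\<Prod>v\<in>?A. x v ^ Poly_Mapping.lookup u v)"
    if "Poly_Mapping.keys u \<subseteq> ?A" for u
    by (rule prod.mono_neutral_left) (use that in \<open>auto simp: in_keys_iff\<close>)
  show ?thesis
    unfolding ext[OF keys_add] ext[of s, OF Un_upper1] ext[of t, OF Un_upper2]
    by (simp add: lookup_add power_add prod.distrib)
qed

lemma poly_eval_single:
  "poly_eval x (Poly_Mapping.single t c) = c * (\<Prod>v\<in>Poly_Mapping.keys t. x v ^ Poly_Mapping.lookup t v)"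
  by (simp add: poly_eval_def)

lemma update_eq_single_add:
  fixes f :: "'a \<Rightarrow>\<^sub>0 'b::monoid_add"
  assumes "t \<notin> Poly_Mapping.keys f"
  shows "Poly_Mapping.update t c f = Poly_Mapping.single t c + f"
  using assms by (intro poly_mapping_eqI) (auto simp: lookup_add lookup_update lookup_single in_keys_iff)

lemma poly_eval_mult: "poly_eval x (f * g) = poly_eval x f * poly_eval x g"
proof (induction f rule: update_induct)
  case const then show ?case by simp
next
  case (update f s c)
  have "poly_eval x (Poly_Mapping.single s c * g) = poly_eval x (Poly_Mapping.single s c) * poly_eval x g"
  proof (induction g rule: update_induct)
    case const then show ?case by simp
  next
    case (update g t d)
    then show ?case
      by (simp add: update_eq_single_add distrib_left poly_eval_add mult_single
          poly_eval_single monomial_eval_add)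
  qed
  with update show ?case
    by (simp add: update_eq_single_add distrib_right poly_eval_add)
qed

text \<open>Packaging \<open>\<complex>\<close> as a ring with explicit carrier makes evaluation at a point a ring homomorphism in the
  sense of locales, so that it commutes with \<^const>\<open>ring_det\<close> for the same reason as the quotient maps do.\<close>

definition complex_ring :: "complex ring" where
  "complex_ring = \<lparr>carrier = UNIV, mult = (*), one = 1, zero = 0, add = (+)\<rparr>"

lemma complex_ring_simps [simp]:
  "carrier complex_ring = UNIV" "x \<otimes>\<^bsub>complex_ring\<^esub> y = x * y" "\<one>\<^bsub>complex_ring\<^esub> = 1"
  "\<zero>\<^bsub>complex_ring\<^esub> = 0" "x \<oplus>\<^bsub>complex_ring\<^esub> y = x + y"
  by (auto simp: complex_ring_def)

lemma cring_complex_ring: "cring complex_ring"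
  by (rule cringI; (rule abelian_groupI comm_monoidI)?)
    (auto simp: algebra_simps intro: exI[of _ "- _"])

interpretation complex_ring: cring complex_ring by (rule cring_complex_ring)

lemma complex_ring_minus [simp]:
  "\<ominus>\<^bsub>complex_ring\<^esub> x = - x" "x \<ominus>\<^bsub>complex_ring\<^esub> y = x - y"
proof -
  show "\<ominus>\<^bsub>complex_ring\<^esub> x = - x" for x by (rule complex_ring.minus_equality) auto
  then show "x \<ominus>\<^bsub>complex_ring\<^esub> y = x - y" by (simp add: a_minus_def)
qed

lemma finsum_complex_ring [simp]: "finsum complex_ring f A = sum f A"
  by (induction A rule: infinite_finite_induct) auto

lemma finprod_complex_ring [simp]: "finprod complex_ring f A = prod f A"
  by (induction A rule: infinite_finite_induct) auto

lemma ring_det_complex_ring: "ring_det complex_ring s X = det (mat s s (\<lambda>(i, j). X i j))"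
proof -
  have "(\<Prod>i<s. X i (p i)) = (\<Prod>i<s. mat s s (\<lambda>(i, j). X i j) $$ (i, p i))" if "p permutes {..<s}" for p
    using permutes_in_image[OF that] by (intro prod.cong) auto
  then show ?thesis
    by (auto simp: ring_det_def det_def'[of _ s] sign_def atLeast0LessThan intro!: sum.cong)
qed

lemma plucker_poly_ring_simps [simp]:
  "x \<otimes>\<^bsub>plucker_poly_ring k n\<^esub> y = x * y" "\<one>\<^bsub>plucker_poly_ring k n\<^esub> = 1"
  "\<zero>\<^bsub>plucker_poly_ring k n\<^esub> = 0" "x \<oplus>\<^bsub>plucker_poly_ring k n\<^esub> y = x + y"
  by (auto simp: plucker_poly_ring_def)

lemma cring_plucker_poly_ring: "cring (plucker_poly_ring k n)"
proof -
  let ?C = "carrier (plucker_poly_ring k n)"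
  have C: "f \<in> ?C \<longleftrightarrow> (\<forall>t\<in>Poly_Mapping.keys f. Poly_Mapping.keys t \<subseteq> plucker_vars k n)" for f
    by (simp add: plucker_poly_ring_def)
  have zero: "0 \<in> ?C" and one: "1 \<in> ?C" by (auto simp: C)
  have add: "f + g \<in> ?C" if "f \<in> ?C" "g \<in> ?C" for f g
    using that keys_add[of f g] unfolding C by blast
  have mult: "f * g \<in> ?C" if "f \<in> ?C" "g \<in> ?C" for f g
    unfolding C
  proof
    fix t assume "t \<in> Poly_Mapping.keys (f * g)"
    then obtain a b where "t = a + b" "a \<in> Poly_Mapping.keys f" "b \<in> Poly_Mapping.keys g"
      using keys_mult[of f g] by blast
    with that keys_add[of a b] show "Poly_Mapping.keys t \<subseteq> plucker_vars k n"
      unfolding C by blast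
  qed
  have neg: "- f \<in> ?C" if "f \<in> ?C" for f
    using that by (simp add: C in_keys_iff)
  show ?thesis
    by (rule cringI; (rule abelian_groupI comm_monoidI)?)
      (auto simp: zero one add mult algebra_simps intro: bexI[OF _ neg])
qed

interpretation plucker_poly: cring "plucker_poly_ring k n" for k n by (rule cring_plucker_poly_ring)

lemma poly_eval_hom: "ring_hom_cring (plucker_poly_ring k n) complex_ring (poly_eval x)"
  by (intro ring_hom_cring.intro ring_hom_cring_axioms.intro cring_plucker_poly_ring cring_complex_ring)
    (auto intro!: ring_hom_memI simp: poly_eval_add poly_eval_mult)

lemma (in ring_hom_cring) hom_ring_det:
  assumes "\<And>i j. i < s \<Longrightarrow> j < s \<Longrightarrow> X i j \<in> carrier R"
  shows "ring_det R s X \<in> carrier R" "h (ring_det R s X) = ring_det S s (\<lambda>i j. h (X i j))"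
proof -
  have X: "X i (p i) \<in> carrier R" if "p permutes {..<s}" "i < s" for p i
    using assms permutes_in_image[OF that(1)] that(2) by auto
  show "ring_det R s X \<in> carrier R"
    unfolding ring_det_def by (intro R.finsum_closed) (auto intro!: R.finprod_closed X)
  have "h (ring_det R s X) = (\<Oplus>\<^bsub>S\<^esub>p\<in>{p. p permutes {..<s}}.
     h ((if evenperm p then \<one> else \<ominus> \<one>) \<otimes> (\<Otimes>i\<in>{..<s}. X i (p i))))"
    unfolding ring_det_def
    by (subst hom_finsum) (auto intro!: R.finprod_closed X simp: o_def)
  also have "\<dots> = ring_det S s (\<lambda>i j. h (X i j))"
    unfolding ring_det_def
  proof (rule S.finsum_cong')
    fix p assume "p \<in> {p. p permutes {..<s}}"
    then have p: "p permutes {..<s}" by simp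
    have "h (\<Otimes>i\<in>{..<s}. X i (p i)) = (\<Otimes>\<^bsub>S\<^esub>i\<in>{..<s}. h (X i (p i)))"
      by (subst hom_finprod) (auto intro!: X[OF p] simp: o_def)
    moreover have "(\<Otimes>i\<in>{..<s}. X i (p i)) \<in> carrier R"
      by (auto intro!: R.finprod_closed X[OF p])
    ultimately show "h ((if evenperm p then \<one> else \<ominus> \<one>) \<otimes> (\<Otimes>i\<in>{..<s}. X i (p i))) =
        (if evenperm p then \<one>\<^bsub>S\<^esub> else \<ominus>\<^bsub>S\<^esub> \<one>\<^bsub>S\<^esub>) \<otimes>\<^bsub>S\<^esub> (\<Otimes>\<^bsub>S\<^esub>i\<in>{..<s}. h (X i (p i)))"
      by simp
  qed (auto intro!: S.finprod_closed X)
  finally show "h (ring_det R s X) = ring_det S s (\<lambda>i j. h (X i j))" .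
qed

lemma ideal_grass_ideal: "ideal (grass_ideal k n) (plucker_poly_ring k n)"
proof (rule idealI)
  let ?Q = "plucker_poly_ring k n"
  interpret ev: ring_hom_cring ?Q complex_ring "poly_eval x" for x by (rule poly_eval_hom)
  show "ring ?Q" by unfold_locales
  show "subgroup (grass_ideal k n) (add_monoid ?Q)"
  proof (rule plucker_poly.add.subgroupI)
    show "grass_ideal k n \<noteq> {}"
      using plucker_poly.zero_closed[of k n] by (auto simp: grass_ideal_def intro!: exI[of _ 0])
    show "\<ominus>\<^bsub>?Q\<^esub> a \<in> grass_ideal k n" if "a \<in> grass_ideal k n" for a
      using that by (auto simp: grass_ideal_def)
    show "a \<oplus>\<^bsub>?Q\<^esub> b \<in> grass_ideal k n" if "a \<in> grass_ideal k n" "b \<in> grass_ideal k n" for a b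
      using that plucker_poly.a_closed[of a k n b] by (auto simp: grass_ideal_def poly_eval_add)
  qed (auto simp: grass_ideal_def)
  show "x \<otimes>\<^bsub>?Q\<^esub> a \<in> grass_ideal k n" if "a \<in> grass_ideal k n" "x \<in> carrier ?Q" for a x
    using that plucker_poly.m_closed[of x k n a] by (auto simp: grass_ideal_def poly_eval_mult)
  show "a \<otimes>\<^bsub>?Q\<^esub> x \<in> grass_ideal k n" if "a \<in> grass_ideal k n" "x \<in> carrier ?Q" for a x
    using that plucker_poly.m_closed[of a k n x] by (auto simp: grass_ideal_def poly_eval_mult)
qed

lemma grass_proj_hom:
  "ring_hom_cring (plucker_poly_ring k n) (grass_ring k n) ((+>\<^bsub>plucker_poly_ring k n\<^esub>) (grass_ideal k n))"
  unfolding grass_ring_def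
  by (rule ideal.rcos_ring_hom_cring[OF ideal_grass_ideal cring_plucker_poly_ring])

section \<open>The special Pluecker frieze\<close>

definition frieze_indices :: "nat \<Rightarrow> nat \<Rightarrow> int \<Rightarrow> int \<Rightarrow> nat list" where
  "frieze_indices k n r m = sort (cyc_interval n (int (red n r)) (k - 1) @ [red n (m + int (red n r) - 1)])"

text \<open>A polynomial representing the Pluecker coordinate of a weakly increasing tuple. Determinants of these
  representatives can be evaluated at points, which is how relations in the quotient are verified.\<close>

definition plucker_rep :: "nat list \<Rightarrow> plucker_poly" where
  "plucker_rep J = (if distinct J then Poly_Mapping.single (Poly_Mapping.single (set J) 1) 1 else 0)"

abbreviation frieze_rep :: "nat \<Rightarrow> nat \<Rightarrow> int \<Rightarrow> int \<Rightarrow> plucker_poly" where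
  "frieze_rep k n \<equiv> \<lambda>r m. plucker_rep (frieze_indices k n r m)"

lemma poly_eval_plucker_rep:
  "poly_eval x (plucker_rep J) = (if distinct J then x (set J) else 0)"
  by (simp add: plucker_rep_def poly_eval_single)

lemma plucker_rep_closed:
  assumes "length J = k" "set J \<subseteq> {1..n}"
  shows "plucker_rep J \<in> carrier (plucker_poly_ring k n)"
  using assms by (auto simp: plucker_rep_def plucker_poly_ring_def plucker_vars_def distinct_card)

lemma plucker_sorted:
  assumes "sorted J"
  shows "plucker k n J = grass_ideal k n +>\<^bsub>plucker_poly_ring k n\<^esub> plucker_rep J"
proof -
  interpret h: ring_hom_cring "plucker_poly_ring k n" "grass_ring k n" "(+>\<^bsub>plucker_poly_ring k n\<^esub>) (grass_ideal k n)"
    by (rule grass_proj_hom)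
  have "\<not> J ! j < J ! i" if "i < j" "j < length J" for i j
    using sorted_nth_mono[OF assms, of i j] that by simp
  then have no_inv: "{(i, j). i < j \<and> j < length J \<and> J ! j < J ! i} = {}"
    by blast
  show ?thesis
    using h.hom_zero unfolding plucker_def no_inv by (auto simp: plucker_rep_def)
qed

lemma set_cyc_interval: "set (cyc_interval n r l) = (\<lambda>j. red n (r + int j)) ` {..<l}"
  by (auto simp: cyc_interval_def)

lemma set_cyc_interval_bounds: "0 < n \<Longrightarrow> set (cyc_interval n r l) \<subseteq> {1..n}"
  using red_bounds by (auto simp: set_cyc_interval)

lemma cyc_interval_red: "0 < n \<Longrightarrow> cyc_interval n (int (red n r)) l = cyc_interval n r l"
  by (simp add: cyc_interval_def red_add_red)

lemma distinct_cyc_interval: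
  assumes "l \<le> n"
  shows "distinct (cyc_interval n r l)"
  unfolding cyc_interval_def distinct_map
proof (intro conjI inj_onI)
  fix x y assume "x \<in> set [0..<l]" "y \<in> set [0..<l]" "red n (r + int x) = red n (r + int y)"
  then have "r + int x = r + int y"
    using assms by (intro red_inj[of n]) auto
  then show "x = y" by simp
qed simp

lemma frieze_indices_eq:
  assumes "0 < n"
  shows "frieze_indices k n r m = sort (cyc_interval n r (k - 1) @ [red n (r + m - 1)])"
  using red_add_red[OF assms, of r "m - 1"] assms
  by (simp add: frieze_indices_def cyc_interval_red algebra_simps)

lemma frieze_rep_closed:
  assumes "0 < n" "0 < k"
  shows "plucker_rep (frieze_indices k n r m) \<in> carrier (plucker_poly_ring k n)"
  using assms set_cyc_interval_bounds[OF assms(1), of r "k - 1"] red_bounds[OF assms(1), of "r + m - 1"]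
  by (intro plucker_rep_closed) (auto simp: frieze_indices_eq cyc_interval_def)

text \<open>In the bottom and top \<open>k - 1\<close> rows the additional index falls back into the window \<open>[r]^(k - 1)\<close>.\<close>

lemma frieze_indices_repeated:
  assumes "0 < n" "1 \<le> m" "m \<le> int k - 1 \<or> int n + 1 \<le> m \<and> m \<le> int n + int k - 1"
  shows "\<not> distinct (frieze_indices k n r m)"
proof -
  define j where "j = (if m \<le> int k - 1 then nat (m - 1) else nat (m - int n - 1))"
  have j: "j < k - 1" using assms by (auto simp: j_def)
  have "r + m - 1 = r + int j \<or> r + m - 1 = r + int j + int n"
    using assms by (auto simp: j_def)
  then have "red n (r + m - 1) = red n (r + int j)"
    using assms(1) by (elim disjE) (simp_all only: red_eq_iff mod_add_self2)
  with j have "red n (r + m - 1) \<in> set (cyc_interval n r (k - 1))"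
    by (auto simp: set_cyc_interval)
  then show ?thesis by (simp add: frieze_indices_eq assms)
qed

text \<open>At a point, the frieze entry in position \<open>(r, m)\<close> is the linear form of the window at \<open>r\<close> applied to the
  column \<open>r + m - 1\<close>; in the rows of zeros both sides vanish because an index is repeated modulo \<open>n\<close>,
  and in the other rows the indices \<open>r, \<dots>, r + k - 2, r + m - 1\<close> increase within one period.\<close>

lemma poly_eval_frieze:
  fixes M :: "complex mat"
  assumes "0 < k" "k \<le> n" "M \<in> carrier_mat k n" "1 \<le> m" "m \<le> int n + int k - 1"
  shows "poly_eval (max_minor k M) (plucker_rep (frieze_indices k n r m))
    = window_bracket k (twisted_col k n M) r (twisted_col k n M (r + m - 1))"
proof (cases "int k \<le> m \<and> m \<le> int n")
  case False
  have n: "0 < n" using assms by simp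
  from False have "\<not> distinct (frieze_indices k n r m)"
    using assms by (intro frieze_indices_repeated) auto
  moreover have "window_bracket k (twisted_col k n M) r (twisted_col k n M (r + m - 1)) = 0"
  proof (cases "m < int k")
    case True
    then show ?thesis
      using window_bracket_zero[of "nat (m - 1)" k "twisted_col k n M" r] assms by (simp add: algebra_simps)
  next
    case m: False
    then show ?thesis
      using window_bracket_zero[of "nat (m - int n - 1)" k "twisted_col k n M" r]
        twisted_col_shift[OF n, of k M "r + int (nat (m - int n - 1))" 1] False assms
      by (simp add: window_bracket_smult algebra_simps)
  qed
  ultimately show ?thesis by (simp add: poly_eval_plucker_rep)
next
  case True
  have n: "0 < n" using assms by simp
  define y where "y j = (if j = k - 1 then r + m - 1 else r + int j)" for j
  have "red n (r + m - 1) \<notin> set (cyc_interval n r (k - 1))"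
  proof
    assume "red n (r + m - 1) \<in> set (cyc_interval n r (k - 1))"
    then obtain j where "j < k - 1" "red n (r + m - 1) = red n (r + int j)"
      by (auto simp: set_cyc_interval)
    then have "r + m - 1 = r + int j"
      using True n by (intro red_inj[of n]) auto
    with \<open>j < k - 1\<close> True show False by auto
  qed
  then have "distinct (frieze_indices k n r m)"
    using assms by (simp add: frieze_indices_eq distinct_cyc_interval)
  moreover have "set (frieze_indices k n r m) = (\<lambda>j. red n (y j)) ` {..<k}"
  proof -
    have "{..<k} = insert (k - 1) {..<k - 1}" using assms by auto
    then show ?thesis using n by (auto simp: frieze_indices_eq set_cyc_interval y_def)
  qed
  moreover have "bracket k (\<lambda>j. twisted_col k n M (y j)) = max_minor k M ((\<lambda>j. red n (y j)) ` {..<k})"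
    by (rule bracket_eq_max_minor) (use True assms n in \<open>auto simp: y_def\<close>)
  moreover have "bracket k (\<lambda>j. twisted_col k n M (y j))
      = window_bracket k (twisted_col k n M) r (twisted_col k n M (r + m - 1))"
    unfolding window_bracket_def by (rule bracket_cong) (auto simp: y_def)
  ultimately show ?thesis by (simp add: poly_eval_plucker_rep)
qed

lemma grass_ideal_memI:
  assumes "f \<in> carrier (plucker_poly_ring k n)"
    and "\<And>M. M \<in> carrier_mat k n \<Longrightarrow> poly_eval (max_minor k M) f = 0"
  shows "f \<in> grass_ideal k n"
  using assms by (simp add: grass_ideal_def)

lemma consecutive_in_carrier:
  assumes "0 < n"
  shows "consecutive_pluckers k n \<subseteq> carrier (grass_ring k n)"
proof
  fix x assume "x \<in> consecutive_pluckers k n"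
  then obtain r where "x = plucker k n (sort (cyc_interval n (int r) k))"
    by (auto simp: consecutive_pluckers_def)
  then have x: "x = grass_ideal k n +>\<^bsub>plucker_poly_ring k n\<^esub> plucker_rep (sort (cyc_interval n (int r) k))"
    by (simp add: plucker_sorted)
  interpret h: ring_hom_cring "plucker_poly_ring k n" "grass_ring k n" "(+>\<^bsub>plucker_poly_ring k n\<^esub>) (grass_ideal k n)"
    by (rule grass_proj_hom)
  have "plucker_rep (sort (cyc_interval n (int r) k)) \<in> carrier (plucker_poly_ring k n)"
    using set_cyc_interval_bounds[OF assms] by (intro plucker_rep_closed) (auto simp: cyc_interval_def)
  then show "x \<in> carrier (grass_ring k n)" by (simp add: x)
qed

definition special_proj :: "nat \<Rightarrow> nat \<Rightarrow> plucker_poly \<Rightarrow> plucker_poly set set" where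
  "special_proj k n f = special_map k n (grass_ideal k n +>\<^bsub>plucker_poly_ring k n\<^esub> f)"

lemma cring_grass_ring: "cring (grass_ring k n)"
  unfolding grass_ring_def
  by (rule ideal.quotient_is_cring[OF ideal_grass_ideal cring_plucker_poly_ring])

lemma ideal_special_ideal:
  assumes "0 < n"
  shows "ideal (special_ideal k n) (grass_ring k n)"
proof -
  interpret G: cring "grass_ring k n" by (rule cring_grass_ring)
  show ?thesis
    unfolding special_ideal_def
    by (rule G.genideal_ideal) (use consecutive_in_carrier[OF assms] in auto)
qed

lemma special_map_hom:
  assumes "0 < n"
  shows "ring_hom_cring (grass_ring k n) (special_grass_ring k n) (special_map k n)"
  unfolding special_map_def[abs_def] special_grass_ring_def
  by (rule ideal.rcos_ring_hom_cring[OF ideal_special_ideal[OF assms] cring_grass_ring])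

lemma special_proj_hom:
  assumes "0 < n"
  shows "ring_hom_cring (plucker_poly_ring k n) (special_grass_ring k n) (special_proj k n)"
proof -
  interpret h: ring_hom_cring "plucker_poly_ring k n" "grass_ring k n" "(+>\<^bsub>plucker_poly_ring k n\<^esub>) (grass_ideal k n)"
    by (rule grass_proj_hom)
  interpret s: ring_hom_cring "grass_ring k n" "special_grass_ring k n" "special_map k n"
    by (rule special_map_hom) fact
  have "special_proj k n = special_map k n \<circ> (+>\<^bsub>plucker_poly_ring k n\<^esub>) (grass_ideal k n)"
    by (simp add: fun_eq_iff special_proj_def)
  then show ?thesis
    by (intro ring_hom_cring.intro ring_hom_cring_axioms.intro cring_plucker_poly_ring s.S.is_cring)
      (simp add: ring_hom_trans[OF h.homh s.homh])
qed

lemma special_map_consecutive: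
  assumes "0 < n" "x \<in> consecutive_pluckers k n"
  shows "special_map k n x = \<one>\<^bsub>special_grass_ring k n\<^esub>"
proof -
  let ?G = "grass_ring k n"
  interpret G: cring ?G by (rule cring_grass_ring)
  interpret J: ideal "special_ideal k n" ?G by (rule ideal_special_ideal) fact
  interpret s: ring_hom_cring ?G "special_grass_ring k n" "special_map k n"
    by (rule special_map_hom) fact
  have x: "x \<in> carrier ?G" using consecutive_in_carrier[OF assms(1)] assms(2) by blast
  have "x \<ominus>\<^bsub>?G\<^esub> \<one>\<^bsub>?G\<^esub> \<in> special_ideal k n"
    unfolding special_ideal_def using consecutive_in_carrier[OF assms(1)] assms(2)
    by (intro subsetD[OF G.genideal_self]) auto
  then have "special_map k n x = special_map k n \<one>\<^bsub>?G\<^esub>"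
    unfolding special_map_def using x by (simp add: G.quotient_eq_iff_same_a_r_cos[OF J.ideal_axioms])
  then show ?thesis by simp
qed

text \<open>Together with \<open>grass_ideal_memI\<close> this reduces an identity in the special ring to the
  same identity for the maximal minors of every complex matrix.\<close>

lemma special_proj_eq_zero:
  assumes "0 < n" "f \<in> grass_ideal k n"
  shows "special_proj k n f = \<zero>\<^bsub>special_grass_ring k n\<^esub>"
proof -
  interpret s: ring_hom_cring "grass_ring k n" "special_grass_ring k n" "special_map k n"
    by (rule special_map_hom) fact
  have "grass_ideal k n +>\<^bsub>plucker_poly_ring k n\<^esub> f = grass_ideal k n"
    by (rule plucker_poly.a_rcos_zero[OF ideal_grass_ideal assms(2)])
  then have "grass_ideal k n +>\<^bsub>plucker_poly_ring k n\<^esub> f = \<zero>\<^bsub>grass_ring k n\<^esub>"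
    by (simp add: grass_ring_def FactRing_def)
  then show ?thesis by (simp add: special_proj_def)
qed

lemma special_plucker_frieze_eq:
  "special_plucker_frieze k n r m = special_proj k n (plucker_rep (frieze_indices k n r m))"
  by (simp add: special_plucker_frieze_def plucker_frieze_def special_proj_def Let_def
      plucker_sorted frieze_indices_def)

text \<open>Row \<open>k\<close> completes the window at \<open>r\<close> on the right and row \<open>n\<close> completes it on the left, to the
  consecutive sets starting at \<open>r\<close> and at \<open>r - 1\<close>.\<close>

lemma special_frieze_one:
  assumes "0 < k" "k \<le> n" "m = int k \<or> m = int n"
  shows "special_plucker_frieze k n r m = \<one>\<^bsub>special_grass_ring k n\<^esub>"
proof -
  have n: "0 < n" using assms by simp
  define q where "q = (if m = int k then r else r - 1)"
  obtain l where l: "k = Suc l" using assms(1) by (cases k) auto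
  have "frieze_indices k n r m = sort (cyc_interval n q k)"
  proof (cases "m = int k")
    case True
    then show ?thesis by (simp add: frieze_indices_eq[OF n] q_def cyc_interval_def l algebra_simps)
  next
    case False
    then have "m = int n" using assms by simp
    then have "red n (r + m - 1) = red n (r - 1)"
      using mod_add_self2[of "r - 1" "int n"] by (simp add: red_eq_iff[OF n] algebra_simps)
    moreover have "cyc_interval n (r - 1) k = red n (r - 1) # cyc_interval n r (k - 1)"
      by (simp add: cyc_interval_def l map_upt_Suc del: upt_Suc)
    moreover have "sort (xs @ [x]) = sort (x # xs)" for x :: nat and xs
      by (rule properties_for_sort[OF _ sorted_sort]) simp
    ultimately show ?thesis
      using False by (simp only: frieze_indices_eq[OF n] q_def if_False)
  qed
  also have "\<dots> = sort (cyc_interval n (int (red n q)) k)" by (simp add: cyc_interval_red n)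
  finally have "plucker k n (frieze_indices k n r m) \<in> consecutive_pluckers k n"
    using red_bounds[OF n, of q] by (force simp: consecutive_pluckers_def)
  then show ?thesis
    using special_map_consecutive[OF n]
    by (simp add: special_plucker_frieze_def plucker_frieze_def Let_def frieze_indices_def)
qed

lemma special_frieze_zero:
  assumes "0 < n" "1 \<le> m" "m \<le> int k - 1 \<or> int n + 1 \<le> m \<and> m \<le> int n + int k - 1"
  shows "special_plucker_frieze k n r m = \<zero>\<^bsub>special_grass_ring k n\<^esub>"
proof -
  interpret p: ring_hom_cring "plucker_poly_ring k n" "special_grass_ring k n" "special_proj k n"
    by (rule special_proj_hom) fact
  show ?thesis
    using frieze_indices_repeated[OF assms, of r] p.hom_zero
    by (simp add: special_plucker_frieze_eq plucker_rep_def)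
qed

lemma poly_eval_frieze_det:
  fixes M :: "complex mat"
  assumes "0 < k" "k < n" "M \<in> carrier_mat k n" "diamond_in_grid k (n - k - 1) s m"
  shows "poly_eval (max_minor k M) (ring_det (plucker_poly_ring k n) s (diamond (frieze_rep k n) r m))
    = det (mat s s (\<lambda>(i, j). window_bracket k (twisted_col k n M) (r + int i) (twisted_col k n M (r + m - 1 + int j))))"
proof -
  interpret ev: ring_hom_cring "plucker_poly_ring k n" complex_ring "poly_eval (max_minor k M)"
    by (rule poly_eval_hom)
  have "poly_eval (max_minor k M) (diamond (frieze_rep k n) r m i j)
    = window_bracket k (twisted_col k n M) (r + int i) (twisted_col k n M (r + m - 1 + int j))"
    if "i < s" "j < s" for i j
  proof -
    have "m + int j - int i \<in> {1..int (n - k - 1) + 2 * int k}"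
      using assms(4) that unfolding diamond_in_grid_def by blast
    then have range: "1 \<le> m + int j - int i" "m + int j - int i \<le> int n + int k - 1"
      using assms(2) by auto
    have "r + int i + (m + int j - int i) - 1 = r + m - 1 + int j" by simp
    then show ?thesis
      using poly_eval_frieze[OF assms(1) less_imp_le[OF assms(2)] assms(3) range, of "r + int i"]
      by (simp only: diamond_def)
  qed
  then have "mat s s (\<lambda>(i, j). poly_eval (max_minor k M) (diamond (frieze_rep k n) r m i j))
    = mat s s (\<lambda>(i, j). window_bracket k (twisted_col k n M) (r + int i) (twisted_col k n M (r + m - 1 + int j)))"
    by (intro eq_matI) auto
  then show ?thesis
    using assms by (subst ev.hom_ring_det(2)) (auto simp: diamond_def ring_det_complex_ring intro!: frieze_rep_closed)
qed

lemma special_frieze_det: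
  assumes "0 < k" "0 < n"
  shows "ring_det (plucker_poly_ring k n) s (diamond (frieze_rep k n) r m)
      \<in> carrier (plucker_poly_ring k n)"
    "ring_det (special_grass_ring k n) s (diamond (special_plucker_frieze k n) r m)
      = special_proj k n (ring_det (plucker_poly_ring k n) s (diamond (frieze_rep k n) r m))"
proof -
  interpret p: ring_hom_cring "plucker_poly_ring k n" "special_grass_ring k n" "special_proj k n"
    by (rule special_proj_hom) fact
  have closed: "diamond (frieze_rep k n) r m i j \<in> carrier (plucker_poly_ring k n)" for i j
    using assms by (simp add: diamond_def frieze_rep_closed)
  show "ring_det (plucker_poly_ring k n) s (diamond (frieze_rep k n) r m)
      \<in> carrier (plucker_poly_ring k n)"
    by (rule p.hom_ring_det(1)) (rule closed)
  have "diamond (special_plucker_frieze k n) r m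
      = (\<lambda>i j. special_proj k n (diamond (frieze_rep k n) r m i j))"
    by (simp add: fun_eq_iff diamond_def special_plucker_frieze_eq)
  then show "ring_det (special_grass_ring k n) s (diamond (special_plucker_frieze k n) r m)
      = special_proj k n (ring_det (plucker_poly_ring k n) s (diamond (frieze_rep k n) r m))"
    by (simp add: p.hom_ring_det(2) closed)
qed

lemma special_frieze_tame:
  assumes "0 < k" "k < n" "diamond_in_grid k (n - k - 1) (k + 1) m"
  shows "ring_det (special_grass_ring k n) (k + 1) (diamond (special_plucker_frieze k n) r m)
    = \<zero>\<^bsub>special_grass_ring k n\<^esub>"
proof -
  have n: "0 < n" using assms by simp
  have "ring_det (plucker_poly_ring k n) (k + 1) (diamond (frieze_rep k n) r m)
      \<in> grass_ideal k n"
    using assms special_frieze_det(1)[OF assms(1) n]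
    by (intro grass_ideal_memI) (simp_all only: poly_eval_frieze_det, simp_all add: det_window_brackets_Suc)
  then show ?thesis
    by (simp only: special_frieze_det(2)[OF assms(1) n] special_proj_eq_zero[OF n])
qed

text \<open>At every point, the determinant of the diamond times one consecutive minor is a product of consecutive
  minors. Hence this is a relation in the coordinate ring, and setting all consecutive coordinates
  to \<open>1\<close> leaves the determinant equal to \<open>1\<close>.\<close>

lemma special_frieze_unimodular:
  assumes "0 < k" "k < n" "diamond_in_grid k (n - k - 1) k m"
  shows "ring_det (special_grass_ring k n) k (diamond (special_plucker_frieze k n) r m)
    = \<one>\<^bsub>special_grass_ring k n\<^esub>"
proof -
  let ?Q = "plucker_poly_ring k n" and ?S = "special_grass_ring k n"
  have n: "0 < n" using assms by simp
  interpret p: ring_hom_cring ?Q ?S "special_proj k n"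
    by (rule special_proj_hom) fact
  define D where "D = ring_det ?Q k (diamond (frieze_rep k n) r m)"
  define P where "P q = plucker_rep (frieze_indices k n q (int k))" for q
  \<comment> \<open>The right-hand side of the relation: all consecutive coordinates from the \<open>k\<close> windows of the rows and from the columns.\<close>
  define L where "L = (\<Otimes>\<^bsub>?Q\<^esub>i\<in>{..<k}. P (r + int i)) \<otimes>\<^bsub>?Q\<^esub> P (r + m - 1)"
  have D: "D \<in> carrier ?Q" unfolding D_def by (rule special_frieze_det) fact+
  have P: "P q \<in> carrier ?Q" for q unfolding P_def by (rule frieze_rep_closed) (use assms n in auto)
  then have prod: "(\<Otimes>\<^bsub>?Q\<^esub>i\<in>{..<k}. P (r + int i)) \<in> carrier ?Q" by (intro plucker_poly.finprod_closed) auto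
  have L: "L \<in> carrier ?Q" unfolding L_def using prod P by (rule plucker_poly.m_closed)
  have "D \<otimes>\<^bsub>?Q\<^esub> P (r + int k - 1) \<ominus>\<^bsub>?Q\<^esub> L \<in> grass_ideal k n"
  proof (rule grass_ideal_memI)
    show "D \<otimes>\<^bsub>?Q\<^esub> P (r + int k - 1) \<ominus>\<^bsub>?Q\<^esub> L \<in> carrier ?Q"
      by (intro plucker_poly.minus_closed plucker_poly.m_closed D P L)
    fix M :: "complex mat" assume M: "M \<in> carrier_mat k n"
    let ?v = "twisted_col k n M"
    interpret ev: ring_hom_cring ?Q complex_ring "poly_eval (max_minor k M)"
      by (rule poly_eval_hom)
    have evP: "poly_eval (max_minor k M) (P q) = bracket k (\<lambda>j. ?v (q + int j))" for q
      unfolding P_def using assms M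
      by (subst poly_eval_frieze) (auto simp: window_bracket_consecutive)
    have evD: "poly_eval (max_minor k M) D
        = det (mat k k (\<lambda>(i, j). window_bracket k ?v (r + int i) (?v (r + m - 1 + int j))))"
      unfolding D_def by (rule poly_eval_frieze_det) fact+
    have evL: "poly_eval (max_minor k M) L
        = (\<Prod>i<k. bracket k (\<lambda>j. ?v (r + int i + int j))) * bracket k (\<lambda>j. ?v (r + m - 1 + int j))"
      unfolding L_def using P by (simp only: ev.hom_mult prod ev.hom_finprod[of _ "{..<k}"] Pi_I)
        (simp add: evP o_def)
    show "poly_eval (max_minor k M) (D \<otimes>\<^bsub>?Q\<^esub> P (r + int k - 1) \<ominus>\<^bsub>?Q\<^esub> L) = 0"
      using det_window_brackets[OF assms(1), of ?v r "\<lambda>j. ?v (r + m - 1 + int j)"]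
      by (simp only: a_minus_def ev.hom_add ev.hom_a_inv ev.hom_mult D P L plucker_poly.m_closed plucker_poly.a_inv_closed evD evP evL)
        simp
  qed
  then have "special_proj k n (D \<otimes>\<^bsub>?Q\<^esub> P (r + int k - 1) \<ominus>\<^bsub>?Q\<^esub> L) = \<zero>\<^bsub>?S\<^esub>"
    by (rule special_proj_eq_zero[OF n])
  moreover have projP: "special_proj k n (P q) = \<one>\<^bsub>?S\<^esub>" for q
    unfolding P_def special_plucker_frieze_eq[symmetric]
    by (rule special_frieze_one) (use assms in auto)
  moreover have "special_proj k n (\<Otimes>\<^bsub>?Q\<^esub>i\<in>{..<k}. P (r + int i)) = \<one>\<^bsub>?S\<^esub>"
    using P by (simp add: p.hom_finprod o_def projP)
  ultimately have "special_proj k n D \<ominus>\<^bsub>?S\<^esub> \<one>\<^bsub>?S\<^esub> = \<zero>\<^bsub>?S\<^esub>"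
    by (simp only: L_def a_minus_def p.hom_add p.hom_a_inv p.hom_mult D P prod plucker_poly.m_closed plucker_poly.a_inv_closed)
      (simp add: D)
  then have "special_proj k n D = \<one>\<^bsub>?S\<^esub>" using D by simp
  then show ?thesis by (simp only: special_frieze_det(2)[OF assms(1) n] D_def)
qed

theorem theorem3p1:
  fixes k n :: nat
  assumes "2 \<le> k" and "2 * k \<le> n"
  shows "tame_SL_frieze (special_grass_ring k n) k (n - k - 1) (special_plucker_frieze k n)"
proof -
  let ?S = "special_grass_ring k n"
  have k: "0 < k" "k < n" and n: "0 < n" using assms by auto
  interpret p: ring_hom_cring "plucker_poly_ring k n" ?S "special_proj k n"
    by (rule special_proj_hom) fact
  have w: "int (n - k - 1) = int n - int k - 1" using k by (simp add: of_nat_diff)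
  have "special_plucker_frieze k n r m \<in> carrier ?S" for r m
    using k n by (simp add: special_plucker_frieze_eq frieze_rep_closed)
  then show ?thesis
    unfolding tame_SL_frieze_def SL_frieze_def
    using assms k n p.S.is_cring special_frieze_tame[OF k] special_frieze_unimodular[OF k]
    by (auto simp: w special_frieze_one special_frieze_zero)
qed

end
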